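(* Let $\mathbf{H}=\mathrm{Diag}(\lambda_1,\dots,\lambda_n)\in\mathbb{R}^{n\times n}$ with $\lambda_1\geq\lambda_2\geq\cdots\geq\lambda_n=1$, let $\{\mathbf{d}_1,\dots,\mathbf{d}_n\}$ be a set of associated orthonormal eigenvectors, $\mathbf{b}\in\mathbb{R}^n$, and $f(\mathbf{x})=\frac12\mathbf{x}^T\mathbf{H}\mathbf{x}+\mathbf{b}^T\mathbf{x}$. Let the NY algorithm (described in the context, with cycle length $T\geq3$) be applied to $\min_{\mathbf{x}\in\mathbb{R}^n}f(\mathbf{x})$ from an initial point $\mathbf{x}_0$ such that $\mathbf{g}_0^T\mathbf{d}_1\neq0$ and $\mathbf{g}_0^T\mathbf{d}_n\neq0$, where $\mathbf{g}_k=\nabla f(\mathbf{x}_k)$. Then the algorithm either terminates in finitely many iterations (i.e. $\mathbf{g}_k=\mathbf{0}$ for some $k$), or the sequence $\{\|\mathbf{g}_k\|\}$ converges to zero $R$-linearly.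
   Context: $R$-linear convergence to zero means that there are $C>0$ and $\theta\in(0,1)$ with $\|\mathbf{g}_k\|\le C\theta^k$ for all $k$. NY algorithm. The norm is Euclidean. Starting from $\mathbf{x}_0$, the algorithm stops at iteration $k$ if $\mathbf{g}_k=\mathbf{0}$; otherwise $\mathbf{x}_{k+1}=\mathbf{x}_k-\alpha_k\mathbf{g}_k$ with $$\alpha_k=\begin{cases}\alpha_k^{SD},&\mathrm{mod}(k,T)<2,\\ \alpha_k^{NY},&\mathrm{mod}(k,T)=2,\\ \alpha_{k-1},&\text{otherwise},\end{cases}$$ where $\alpha_k^{SD}=\frac{\mathbf{g}_k^T\mathbf{g}_k}{\mathbf{g}_k^T\mathbf{H}\mathbf{g}_k}$ is the Cauchy stepsize, and $\alpha_k^{NY}$ is defined as follows (for $\mathrm{mod}(k,T)=2$, so that iterations $k-2$ and $k-1$ used Cauchy stepsizes). Put $$\beta=\frac{\|\mathbf{g}_k\|^2}{(\alpha_{k-1}^{SD})^2\|\mathbf{g}_{k-1}\|^2},\quad \gamma=\frac{(\mathbf{g}_k^T\mathbf{g}_{k-2})^2}{\|\mathbf{g}_{k-2}\|^2\|\mathbf{g}_k\|^2}.$$ If $\mathbf{g}_{k-2}$ and $\mathbf{g}_k$ are not parallel, put $a_{11}=\frac{1}{\alpha_{k-2}^{SD}}$, $a_{22}=\frac{1}{\alpha_{k-1}^{SD}}$, $a_{33}=\frac{1/\alpha_k^{SD}-\gamma/\alpha_{k-2}^{SD}}{1-\gamma}$, $$t_1=a_{11}+a_{22}+a_{33},\quad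 t_2=a_{11}a_{22}+(a_{11}+a_{22})a_{33}-\beta,\quad t_3=a_{11}a_{22}a_{33}-a_{11}\beta(1-\gamma)-a_{33}\beta\gamma,$$ $p=t_2-\frac{t_1^2}{3}$, $q=-\frac{2t_1^3}{27}+\frac{t_1t_2}{3}-t_3$; then $$(\alpha_k^{NY})^{-1}=\frac{t_1}{3}+2\sqrt{-\frac p3}\cos\Big(\frac13\arccos\Big(\frac{3q}{2p}\sqrt{\frac{-3}{p}}\Big)\Big),$$ the largest root of $\mu^3-t_1\mu^2+t_2\mu-t_3=0$. If $\mathbf{g}_{k-2}$ and $\mathbf{g}_k$ are parallel, $(\alpha_k^{NY})^{-1}$ is the largest root of $(\mu-\frac{1}{\alpha_{k-2}^{SD}})(\mu-\frac{1}{\alpha_{k-1}^{SD}})-\beta=0$ (so that $\alpha_k^{NY}$ is Yuan's stepsize). *)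

theory Defs
  imports "HOL-Analysis.Analysis"
begin

definition diag :: "('n::finite \<Rightarrow> real) \<Rightarrow> real^'n^'n" where
  "diag l = (\<chi> i j. if i = j then l i else 0)"

definition quadratic :: "real^'n^'n \<Rightarrow> real^'n \<Rightarrow> real^'n \<Rightarrow> real" where
  "quadratic H b x = 1/2 * (x \<bullet> (H *v x)) + b \<bullet> x"

definition sd_step :: "real^'n^'n \<Rightarrow> real^'n \<Rightarrow> real" where
  "sd_step H g = (g \<bullet> g) / (g \<bullet> (H *v g))"

text \<open>
  The arguments \<open>g0\<close>, \<open>g1\<close>, \<open>g2\<close> are the gradients at iterations \<open>k-2\<close>, \<open>k-1\<close>, \<open>k\<close>.
  They are nonzero whenever the algorithm evaluates this stepsize, so that
  \<open>collinear {0, g0, g2}\<close> says that \<open>g0\<close> and \<open>g2\<close> are parallel.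
  In that case \<open>\<beta> > 0\<close>, so the set of roots under \<open>Max\<close> is finite and nonempty.
\<close>
definition ny_step :: "real^'n^'n \<Rightarrow> real^'n \<Rightarrow> real^'n \<Rightarrow> real^'n \<Rightarrow> real" where
  "ny_step H g0 g1 g2 =
    (let \<beta> = (norm g2)\<^sup>2 / ((sd_step H g1)\<^sup>2 * (norm g1)\<^sup>2);
         \<gamma> = (g2 \<bullet> g0)\<^sup>2 / ((norm g0)\<^sup>2 * (norm g2)\<^sup>2)
     in if collinear {0, g0, g2}
        then inverse (Max {\<mu>. (\<mu> - 1 / sd_step H g0) * (\<mu> - 1 / sd_step H g1) - \<beta> = 0})
        else
          (let a11 = 1 / sd_step H g0;
               a22 = 1 / sd_step H g1;
               a33 = (1 / sd_step H g2 - \<gamma> / sd_step H g0) / (1 - \<gamma>);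
               t1 = a11 + a22 + a33;
               t2 = a11 * a22 + (a11 + a22) * a33 - \<beta>;
               t3 = a11 * a22 * a33 - a11 * \<beta> * (1 - \<gamma>) - a33 * \<beta> * \<gamma>;
               p = t2 - t1\<^sup>2 / 3;
               q = - (2 * t1 ^ 3 / 27) + t1 * t2 / 3 - t3
           in inverse (t1 / 3 + 2 * sqrt (- p / 3)
                * cos (1/3 * arccos (3 * q / (2 * p) * sqrt (- 3 / p))))))"

text \<open>
  The sequences are constrained only until the first vanishing gradient, where the
  algorithm stops; their values after that point are arbitrary.
\<close>
definition ny_run ::
  "real^'n^'n \<Rightarrow> nat \<Rightarrow> (nat \<Rightarrow> real^'n) \<Rightarrow> (nat \<Rightarrow> real^'n) \<Rightarrow> (nat \<Rightarrow> real) \<Rightarrow> bool" where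
  "ny_run H T x g \<alpha> \<longleftrightarrow>
    (\<forall>k. (\<forall>j\<le>k. g j \<noteq> 0) \<longrightarrow>
      \<alpha> k = (if k mod T < 2 then sd_step H (g k)
             else if k mod T = 2 then ny_step H (g (k - 2)) (g (k - 1)) (g k)
             else \<alpha> (k - 1)) \<and>
      x (Suc k) = x k - \<alpha> k *\<^sub>R g k)"

definition R_linear_to_zero :: "(nat \<Rightarrow> real) \<Rightarrow> bool" where
  "R_linear_to_zero u \<longleftrightarrow>
    (\<exists>C \<theta>. C > 0 \<and> 0 < \<theta> \<and> \<theta> < 1 \<and> (\<forall>k. \<bar>u k\<bar> \<le> C * \<theta> ^ k))"

end

theory Submission
  imports Defs
begin

text \<open>
  The number \<open>1 / \<alpha>\<^sup>N\<^sup>Y\<close> is the largest Ritz value of \<open>H\<close> on the span of \<open>g\<^sub>k\<^sub>-\<^sub>2\<close>, \<open>g\<^sub>k\<^sub>-\<^sub>1\<close>, \<open>g\<^sub>k\<close>: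
  consecutive gradients are orthogonal and \<open>H g\<^sub>k\<^sub>-\<^sub>2\<close> is orthogonal to the component of \<open>g\<^sub>k\<close> normal to
  \<open>g\<^sub>k\<^sub>-\<^sub>2\<close>, so \<open>H\<close> is represented there by a tridiagonal matrix whose characteristic polynomial is
  the cubic of the algorithm. Hence every \<open>1 / \<alpha>\<^sub>k\<close> is at most \<open>\<lambda>\<^sub>1\<close> and dominates the Rayleigh
  quotient of some gradient \<open>g\<^sub>v\<close> with \<open>k - T \<le> v \<le> k\<close>.

  The \<open>i\<close>-th component of the gradient is multiplied by \<open>1 - \<alpha>\<^sub>k \<lambda>\<^sub>i\<close>. If \<open>\<alpha>\<^sub>k \<lambda>\<^sub>i \<le> 3 / 2\<close>, it contracts
  by a fixed factor. Otherwise the Rayleigh quotient of \<open>g\<^sub>v\<close> is below \<open>2 \<lambda>\<^sub>i / 3\<close>, which bounds the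
  \<open>i\<close>-th component of \<open>g\<^sub>v\<close> by the components with smaller eigenvalues. Induction along increasing
  eigenvalues makes every component decay geometrically.
\<close>

section \<open>Geometric decay from delayed short steps\<close>

text \<open>The first alternative serves steps that contract a component, the second those where
  components already known to decay dominate it. The rate \<open>max c \<theta>\<close> is positive
  even for negative \<open>c\<close>.\<close>

lemma decay_or_dominated_imp_geometric:
  fixes u :: "nat \<Rightarrow> real"
  assumes u: "\<And>k. 0 \<le> u k" and c: "c < 1" and \<theta>: "0 < \<theta>" "\<theta> < 1"
    and step: "\<And>k. u (Suc k) \<le> c * u k \<or> u (Suc k) \<le> C * \<theta> ^ Suc k"
  shows "\<exists>C' \<theta>'. 0 < C' \<and> 0 < \<theta>' \<and> \<theta>' < 1 \<and> (\<forall>k. u k \<le> C' * \<theta>' ^ k)"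
proof (intro exI conjI allI)
  define \<theta>' where "\<theta>' = max c \<theta>"
  define C' where "C' = max 1 (max (u 0) C)"
  show "0 < C'" "0 < \<theta>'" "\<theta>' < 1"
    using c \<theta> by (auto simp: C'_def \<theta>'_def)
  show "u k \<le> C' * \<theta>' ^ k" for k
  proof (induction k)
    case 0
    show ?case by (simp add: C'_def)
  next
    case (Suc k)
    from step[of k] show ?case
    proof
      assume "u (Suc k) \<le> c * u k"
      also have "\<dots> \<le> \<theta>' * u k"
        using u by (intro mult_right_mono) (auto simp: \<theta>'_def)
      also have "\<dots> \<le> \<theta>' * (C' * \<theta>' ^ k)"
        using Suc \<open>0 < \<theta>'\<close> by simp
      finally show ?thesis by (simp add: ac_simps)
    next
      assume "u (Suc k) \<le> C * \<theta> ^ Suc k"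
      also have "\<dots> \<le> C' * \<theta>' ^ Suc k"
        using \<theta> \<open>0 < C'\<close> by (intro mult_mono power_mono) (auto simp: C'_def \<theta>'_def)
      finally show ?thesis .
    qed
  qed
qed

lemma sum_geometric_bound:
  fixes u :: "nat \<Rightarrow> 'a \<Rightarrow> real"
  assumes "finite J"
    and "\<And>j. j \<in> J \<Longrightarrow> \<exists>C \<theta>. 0 < C \<and> 0 < \<theta> \<and> \<theta> < 1 \<and> (\<forall>k. u k j \<le> C * \<theta> ^ k)"
  shows "\<exists>C \<theta>. 0 < C \<and> 0 < \<theta> \<and> \<theta> < 1 \<and> (\<forall>k. (\<Sum>j\<in>J. u k j) \<le> C * \<theta> ^ k)"
  using assms
proof (induction J rule: finite_induct)
  case empty
  show ?case by (rule exI[of _ 1], rule exI[of _ "1/2"]) simp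
next
  case (insert j J)
  then obtain C \<theta> where C: "0 < C" "0 < \<theta>" "\<theta> < 1" "\<And>k. (\<Sum>j\<in>J. u k j) \<le> C * \<theta> ^ k"
    by (metis insertI2)
  obtain D \<eta> where D: "0 < D" "0 < \<eta>" "\<eta> < 1" "\<And>k. u k j \<le> D * \<eta> ^ k"
    using insert.prems by blast
  have "(\<Sum>j\<in>insert j J. u k j) \<le> (D + C) * max \<eta> \<theta> ^ k" for k
  proof -
    have "D * \<eta> ^ k \<le> D * max \<eta> \<theta> ^ k" "C * \<theta> ^ k \<le> C * max \<eta> \<theta> ^ k"
      using C D by (auto intro!: mult_left_mono power_mono)
    with C(4)[of k] D(4)[of k] insert.hyps show ?thesis
      by (simp add: distrib_right)
  qed
  with C D show ?case
    by (intro exI[of _ "D + C"] exI[of _ "max \<eta> \<theta>"]) auto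
qed

text \<open>\<open>delay\<close> bounds \<open>\<alpha> k\<close> by the reciprocal Rayleigh
  quotient of a recent \<open>u v\<close>; in multiplied-out form it also makes sense when
  \<open>u v\<close> is zero.\<close>

lemma short_delayed_steps_imp_geometric:
  fixes u :: "nat \<Rightarrow> real^'n" and l :: "'n \<Rightarrow> real" and \<alpha> :: "nat \<Rightarrow> real"
  assumes rec: "\<And>k i. u (Suc k) $ i = (1 - \<alpha> k * l i) * u k $ i"
    and l: "\<And>i. 1 \<le> l i" "\<And>i. l i \<le> L"
    and \<alpha>: "\<And>k. 1 / L \<le> \<alpha> k" "\<And>k. \<alpha> k \<le> 1"
    and delay: "\<And>k. \<exists>v\<le>k. k \<le> v + m \<and> \<alpha> k * (\<Sum>j\<in>UNIV. l j * (u v $ j)\<^sup>2) \<le> (\<Sum>j\<in>UNIV. (u v $ j)\<^sup>2)"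
  shows "\<exists>C \<theta>. 0 < C \<and> 0 < \<theta> \<and> \<theta> < 1 \<and> (\<forall>k. \<bar>u k $ i\<bar> \<le> C * \<theta> ^ k)"
\<comment> \<open>Counting strictly smaller eigenvalues copes with repeated ones: components with
  the same eigenvalue as \<open>i\<close> go into \<open>B\<close> below.\<close>
proof (induction "card {j. l j < l i}" arbitrary: i rule: less_induct)
  case less
  define S where "S k = (\<Sum>j | l j < l i. \<bar>u k $ j\<bar>)" for k
  have L: "1 \<le> L" using l order_trans by blast
  then have \<alpha>_pos: "0 < \<alpha> k" for k
    using \<alpha>(1)[of k] by (smt (verit) divide_pos_pos)
  have "\<exists>C \<theta>. 0 < C \<and> 0 < \<theta> \<and> \<theta> < 1 \<and> (\<forall>k. S k \<le> C * \<theta> ^ k)"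
    unfolding S_def
  proof (rule sum_geometric_bound)
    fix j assume "j \<in> {j. l j < l i}"
    then have "{j'. l j' < l j} \<subset> {j. l j < l i}" by auto
    then show "\<exists>C \<theta>. 0 < C \<and> 0 < \<theta> \<and> \<theta> < 1 \<and> (\<forall>k. \<bar>u k $ j\<bar> \<le> C * \<theta> ^ k)"
      by (intro less psubset_card_mono) auto
  qed simp
  then obtain C \<theta> where C: "0 < C" "0 < \<theta>" "\<theta> < 1" "\<And>k. S k \<le> C * \<theta> ^ k" by blast
  \<comment> \<open>This crude growth bound carries an estimate at the delayed index
    \<open>v\<close> forward to \<open>Suc k\<close>, over at most \<open>Suc m\<close>
    steps.\<close>
  have growth: "\<bar>u (v + t) $ i\<bar> \<le> L ^ t * \<bar>u v $ i\<bar>" for v t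
  proof (induction t)
    case (Suc t)
    have "0 \<le> \<alpha> (v + t) * l i" using \<alpha>_pos[of "v + t"] l(1)[of i] by simp
    moreover have "\<alpha> (v + t) * l i \<le> 1 * L"
      using \<alpha>(2) l(2) L l(1)[of i] by (intro mult_mono) auto
    ultimately have "\<bar>1 - \<alpha> (v + t) * l i\<bar> \<le> L" using L by linarith
    then have "\<bar>u (v + Suc t) $ i\<bar> \<le> L * \<bar>u (v + t) $ i\<bar>"
      by (simp add: rec abs_mult mult_right_mono)
    also have "\<dots> \<le> L * (L ^ t * \<bar>u v $ i\<bar>)"
      using Suc L by (intro mult_left_mono) auto
    finally show ?case by (simp add: ac_simps)
  qed simp
  \<comment> \<open>If \<open>\<alpha> k * l i\<close> lies between \<open>1 / L\<close> and
    \<open>3 / 2\<close>, its distance from 1 is at most \<open>c\<close>. In \<open>D\<close>, the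
    power of \<open>L\<close> is the growth over the delay, 2 comes from \<open>uv\<close>, and the
    division by a power of \<theta> compensates for the delay.\<close>
  define c where "c = max (1/2) (1 - 1 / L)"
  define D where "D = L ^ Suc m * 2 * C / \<theta> ^ Suc m"
  have "\<bar>u (Suc k) $ i\<bar> \<le> c * \<bar>u k $ i\<bar> \<or> \<bar>u (Suc k) $ i\<bar> \<le> D * \<theta> ^ Suc k" for k
  proof (cases "\<alpha> k * l i \<le> 3 / 2")
    case True
    have "1 / L * 1 \<le> \<alpha> k * l i"
      using \<alpha>(1) l(1) \<alpha>_pos by (intro mult_mono) (auto intro: less_imp_le)
    with True have "\<bar>1 - \<alpha> k * l i\<bar> \<le> c" unfolding c_def by linarith
    then show ?thesis by (simp add: rec abs_mult mult_right_mono)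
  next
    case False
    obtain v where v: "v \<le> k" "k \<le> v + m"
        "\<alpha> k * (\<Sum>j\<in>UNIV. l j * (u v $ j)\<^sup>2) \<le> (\<Sum>j\<in>UNIV. (u v $ j)\<^sup>2)"
      using delay by blast
    \<comment> \<open>\<open>A\<close> is the part already known to decay. A long step turns
      \<open>delay\<close> into \<open>3 / 2 * B \<le> A + B\<close>, hence
      \<open>B \<le> 2 * A\<close>.\<close>
    define A where "A = (\<Sum>j | l j < l i. (u v $ j)\<^sup>2)"
    define B where "B = (\<Sum>j | \<not> l j < l i. (u v $ j)\<^sup>2)"
    have split: "sum h UNIV = sum h {j. l j < l i} + sum h {j. \<not> l j < l i}" for h :: "'n \<Rightarrow> real"
      by (subst sum.union_disjoint[symmetric]) (auto intro: arg_cong2[where f=sum])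
    have "B \<ge> 0" by (simp add: B_def sum_nonneg)
    have "l i * B \<le> (\<Sum>j | \<not> l j < l i. l j * (u v $ j)\<^sup>2)"
      unfolding B_def sum_distrib_left by (intro sum_mono mult_right_mono) auto
    also have "\<dots> \<le> (\<Sum>j\<in>UNIV. l j * (u v $ j)\<^sup>2)"
      using l(1) by (intro sum_mono2) (auto intro!: mult_nonneg_nonneg intro: order_trans[OF zero_le_one])
    finally have "\<alpha> k * (l i * B) \<le> A + B"
      using v(3) \<alpha>_pos[of k] by (simp add: split[of "\<lambda>j. (u v $ j)\<^sup>2"] A_def B_def)
        (smt (verit) mult_left_mono)
    moreover have "3 / 2 * B \<le> \<alpha> k * (l i * B)"
      using False mult_right_mono[of "3 / 2" "\<alpha> k * l i" B] \<open>B \<ge> 0\<close> by (simp add: mult.assoc)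
    ultimately have "B \<le> 2 * A" by linarith
    moreover have "(u v $ i)\<^sup>2 \<le> B"
      unfolding B_def by (rule member_le_sum) auto
    moreover have "A \<le> (S v)\<^sup>2"
    proof -
      have "A = (L2_set (\<lambda>j. u v $ j) {j. l j < l i})\<^sup>2"
        by (simp add: A_def L2_set_def sum_nonneg)
      also have "\<dots> \<le> (S v)\<^sup>2"
        unfolding S_def by (intro power_mono L2_set_le_sum_abs L2_set_nonneg)
      finally show ?thesis .
    qed
    \<comment> \<open>Weakening the factor 2 to 4 avoids a square root of 2.\<close>
    ultimately have "\<bar>u v $ i\<bar>\<^sup>2 \<le> (2 * S v)\<^sup>2"
      by (simp add: power_mult_distrib) (smt (verit) zero_le_power2)
    then have uv: "\<bar>u v $ i\<bar> \<le> 2 * S v"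
      by (rule power2_le_imp_le) (simp add: S_def sum_nonneg)
    have "\<bar>u (Suc k) $ i\<bar> \<le> L ^ (Suc k - v) * \<bar>u v $ i\<bar>"
      using growth[of v "Suc k - v"] v(1) by simp
    also have "\<dots> \<le> L ^ Suc m * (2 * (C * \<theta> ^ v))"
      using L v uv C(4)[of v] by (intro mult_mono power_increasing) (auto simp: le_diff_conv)
    also have "\<dots> = D * \<theta> ^ (v + Suc m)"
      using C(2) by (simp add: D_def power_add)
    also have "\<dots> \<le> D * \<theta> ^ Suc k"
      using C L v by (intro mult_left_mono power_decreasing) (auto simp: D_def)
    finally show ?thesis ..
  qed
  moreover have "c < 1" using L by (simp add: c_def)
  ultimately show ?case
    using C by (intro decay_or_dominated_imp_geometric[where c = c and C = D and \<theta> = \<theta>]) auto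
qed

section \<open>Roots of the tridiagonal characteristic cubic\<close>

text \<open>Viete's substitution \<open>y = 2 * s * cos t\<close> turns the cubic into
  \<open>2 * s ^ 3 * cos (3 * t) + q\<close>. The points \<open>y1\<close> and \<open>y2\<close>
  certify that the arccosine argument is legitimate.\<close>

lemma depressed_cubic_trig_root:
  fixes q s y1 y2 :: real
  assumes s: "0 < s"
    and y1: "y1 \<le> 2 * s" "0 \<le> y1 ^ 3 - 3 * s\<^sup>2 * y1 + q"
    and y2: "- 2 * s \<le> y2" "y2 ^ 3 - 3 * s\<^sup>2 * y2 + q \<le> 0"
  defines "y \<equiv> 2 * s * cos (1/3 * arccos (- q / (2 * s ^ 3)))"
  shows "y ^ 3 - 3 * s\<^sup>2 * y + q = 0" and "y2 \<le> y"
proof -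
  define t where "t = 1/3 * arccos (- q / (2 * s ^ 3))"
  have y: "y = 2 * s * cos t" by (simp add: y_def t_def)
  \<comment> \<open>\<open>s\<close> and \<open>-s\<close> are the critical points of the cubic; the arccos is not a junk value iff it is
    nonpositive at \<open>s\<close> and nonnegative at \<open>-s\<close>\<close>
  have "0 \<le> (y2 - s)\<^sup>2 * (y2 + 2 * s)" using y2 by simp
  then have 1: "q \<le> 2 * s ^ 3"
    using y2(2) by (simp add: algebra_simps power2_eq_square power3_eq_cube)
  have "0 \<le> (y1 + s)\<^sup>2 * (2 * s - y1)" using y1 by simp
  then have 2: "- q \<le> 2 * s ^ 3"
    using y1(2) by (simp add: algebra_simps power2_eq_square power3_eq_cube)
  have arg: "- 1 \<le> - q / (2 * s ^ 3)" "- q / (2 * s ^ 3) \<le> 1"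
    using 1 2 s by (auto simp: field_simps)
  have "cos (3 * t) = - q / (2 * s ^ 3)"
    using arg by (simp add: t_def)
  then have "4 * cos t ^ 3 - 3 * cos t = - q / (2 * s ^ 3)"
    by (simp add: cos_treble_cos)
  then have "2 * s ^ 3 * (4 * cos t ^ 3 - 3 * cos t) = - q"
    using s by (simp add: field_simps)
  then show root: "y ^ 3 - 3 * s\<^sup>2 * y + q = 0"
    unfolding y by (simp add: algebra_simps power2_eq_square power3_eq_cube)
  \<comment> \<open>This range of \<open>t\<close> puts \<open>y\<close> at or beyond the larger
    critical point \<open>s\<close>, where the cubic increases strictly; so \<open>y2\<close> cannot
    exceed \<open>y\<close>.\<close>
  have "0 \<le> t" "t \<le> pi / 3"
    using arccos_bounded[OF arg] by (auto simp: t_def)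
  then have "cos (pi / 3) \<le> cos t"
    using pi_gt_zero by (intro cos_monotone_0_pi_le) linarith+
  then have ys: "s \<le> y"
    using s by (simp add: y cos_60)
  show "y2 \<le> y"
  proof (rule ccontr)
    assume "\<not> y2 \<le> y"
    then have "y < y2" by simp
    have "s * s \<le> y * y" "s * s < y * y2" "s * s < y2 * y2"
      using s ys \<open>y < y2\<close> by (auto intro!: mult_mono mult_strict_mono' mult_le_less_imp_less)
    then have "0 < y2\<^sup>2 + y2 * y + y\<^sup>2 - 3 * s\<^sup>2"
      by (simp add: power2_eq_square mult.commute)
    with \<open>y < y2\<close> have "0 < (y2 - y) * (y2\<^sup>2 + y2 * y + y\<^sup>2 - 3 * s\<^sup>2)" by simp
    also have "\<dots> \<le> 0"
      using root y2(2) by (simp add: algebra_simps power2_eq_square power3_eq_cube)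
    finally show False by simp
  qed
qed

text \<open>The matrix has diagonal \<open>a\<close>, \<open>b\<close>, \<open>c\<close> and squared
  off-diagonal entries \<open>\<beta> * \<gamma>\<close> and
  \<open>\<beta> * (1 - \<gamma>)\<close>; \<open>t1\<close>, \<open>t2\<close>, \<open>t3\<close>
  are its trace, sum of principal 2 by 2 minors and determinant. Deleting the middle row and column
  leaves \<open>a\<close> and \<open>c\<close>, so interlacing explains the lower bounds.\<close>

lemma tridiagonal_cubic_trig_root:
  fixes a b c \<beta> \<gamma> :: real
  assumes \<beta>: "0 < \<beta>" and \<gamma>: "0 \<le> \<gamma>" "\<gamma> \<le> 1"
  defines "t1 \<equiv> a + b + c"
    and "t2 \<equiv> a * b + (a + b) * c - \<beta>"
    and "t3 \<equiv> a * b * c - a * \<beta> * (1 - \<gamma>) - c * \<beta> * \<gamma>"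
  defines "p \<equiv> t2 - t1\<^sup>2 / 3"
    and "q \<equiv> - (2 * t1 ^ 3 / 27) + t1 * t2 / 3 - t3"
  defines "\<mu> \<equiv> t1 / 3 + 2 * sqrt (- p / 3) * cos (1/3 * arccos (3 * q / (2 * p) * sqrt (- 3 / p)))"
  shows "(\<mu> - a) * (\<mu> - b) * (\<mu> - c) - \<beta> * (1 - \<gamma>) * (\<mu> - a) - \<beta> * \<gamma> * (\<mu> - c) = 0"
    and "a \<le> \<mu>" and "c \<le> \<mu>"
proof -
  define s where "s = sqrt (- p / 3)"
  define f where "f x = (x - a) * (x - b) * (x - c) - \<beta> * (1 - \<gamma>) * (x - a) - \<beta> * \<gamma> * (x - c)" for x
  \<comment> \<open>Strict negativity of \<open>p\<close> gives both square roots in the formula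
    their intended meaning.\<close>
  have "- 6 * p = (a - b)\<^sup>2 + (b - c)\<^sup>2 + (a - c)\<^sup>2 + 6 * \<beta>"
    by (simp add: p_def t1_def t2_def field_simps power2_eq_square)
  moreover have "0 \<le> (a - b)\<^sup>2 + (b - c)\<^sup>2 + (a - c)\<^sup>2" by simp
  ultimately have "p < 0" using \<beta> by linarith
  then have s: "0 < s" and s2: "s\<^sup>2 = - p / 3" by (simp_all add: s_def)
  have p: "p = - 3 * s\<^sup>2" using s2 by simp
  have "- 3 / p = (1 / s)\<^sup>2" using s by (simp add: p power_divide)
  then have "sqrt (- 3 / p) = 1 / s" using s by simp
  then have "3 * q / (2 * p) * sqrt (- 3 / p) = - q / (2 * s ^ 3)"
    using s by (simp add: p power2_eq_square power3_eq_cube)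
  then have \<mu>: "\<mu> = t1 / 3 + 2 * s * cos (1/3 * arccos (- q / (2 * s ^ 3)))"
    by (simp only: \<mu>_def s_def)
  have "f x = (x - t1 / 3) ^ 3 + p * (x - t1 / 3) + q" for x
    by (simp add: f_def q_def p_def t1_def t2_def t3_def field_simps power2_eq_square power3_eq_cube)
  then have f: "f x = (x - t1 / 3) ^ 3 - 3 * s\<^sup>2 * (x - t1 / 3) + q" for x
    by (simp add: p)
  \<comment> \<open>After the shift by \<open>t1 / 3\<close>, \<open>a\<close> and \<open>c\<close>
    can thus serve as the certifying points \<open>y1\<close> and \<open>y2\<close>, in the order
    given by their size.\<close>
  have near: "\<bar>x - t1 / 3\<bar> \<le> 2 * s" if "x = a \<or> x = c" for x
  proof -
    have "4 * s\<^sup>2 - (a - t1 / 3)\<^sup>2 = ((b - c)\<^sup>2 + 4 * \<beta>) / 3"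
         "4 * s\<^sup>2 - (c - t1 / 3)\<^sup>2 = ((a - b)\<^sup>2 + 4 * \<beta>) / 3"
      unfolding s2 by (simp_all add: p_def t1_def t2_def field_simps power2_eq_square)
    with \<beta> that have "(x - t1 / 3)\<^sup>2 \<le> (2 * s)\<^sup>2"
      by (auto simp: power_mult_distrib) (smt (verit) zero_le_power2 divide_nonneg_pos)+
    then have "\<bar>x - t1 / 3\<bar> \<le> \<bar>2 * s\<bar>" by (simp only: abs_le_square_iff)
    with s show ?thesis by simp
  qed
  define x1 where "x1 = min a c"
  define x2 where "x2 = max a c"
  \<comment> \<open>\<open>f a = \<beta> \<gamma> (c - a)\<close> and \<open>f c = \<beta> (1 - \<gamma>) (a - c)\<close>, so \<open>f\<close> changes sign downwards between \<open>a\<close> and \<open>c\<close>\<close>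
  have "0 \<le> f x1" "f x2 \<le> 0"
    using \<beta> \<gamma> by (auto simp: x1_def x2_def f_def min_def max_def mult_le_0_iff zero_le_mult_iff)
  moreover have "\<bar>x1 - t1 / 3\<bar> \<le> 2 * s" "\<bar>x2 - t1 / 3\<bar> \<le> 2 * s"
    using near by (auto simp: x1_def x2_def min_def max_def)
  ultimately have y: "x1 - t1 / 3 \<le> 2 * s" "0 \<le> (x1 - t1 / 3) ^ 3 - 3 * s\<^sup>2 * (x1 - t1 / 3) + q"
      "- 2 * s \<le> x2 - t1 / 3" "(x2 - t1 / 3) ^ 3 - 3 * s\<^sup>2 * (x2 - t1 / 3) + q \<le> 0"
    unfolding f by auto
  note root = depressed_cubic_trig_root[OF s y]
  have "f \<mu> = 0" using root(1) by (simp add: f \<mu>)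
  then show "(\<mu> - a) * (\<mu> - b) * (\<mu> - c) - \<beta> * (1 - \<gamma>) * (\<mu> - a) - \<beta> * \<gamma> * (\<mu> - c) = 0"
    by (simp add: f_def)
  from root(2) have "x2 \<le> \<mu>" by (simp add: \<mu>)
  then show "a \<le> \<mu>" "c \<le> \<mu>" by (auto simp: x2_def)
qed

section \<open>Ritz values and the quadratic of Yuan's stepsize\<close>

text \<open>An eigenvector of the compressed matrix lifts to a vector \<open>z\<close> whose
  Rayleigh quotient under \<open>H\<close> is \<mu>. The nonzero off-diagonal entries keep the
  explicit \<open>z\<close> nonzero.\<close>

lemma tridiagonal_ritz_value_le:
  fixes H :: "real^'n^'n" and q1 q2 q3 :: "real^'n"
  assumes sym: "\<And>y z. y \<bullet> (H *v z) = z \<bullet> (H *v y)"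
    and upper: "\<And>z. z \<bullet> (H *v z) \<le> L * (z \<bullet> z)"
    and unit: "q1 \<bullet> q1 = 1" "q2 \<bullet> q2 = 1" "q3 \<bullet> q3 = 1"
    and orth: "q1 \<bullet> q2 = 0" "q1 \<bullet> q3 = 0" "q2 \<bullet> q3 = 0"
    and diag: "q1 \<bullet> (H *v q1) = a" "q2 \<bullet> (H *v q2) = b" "q3 \<bullet> (H *v q3) = c"
    and offdiag: "q1 \<bullet> (H *v q2) = e" "q2 \<bullet> (H *v q3) = h" "q1 \<bullet> (H *v q3) = 0"
    and nz: "e \<noteq> 0" "h \<noteq> 0"
    and root: "(\<mu> - a) * (\<mu> - b) * (\<mu> - c) - h\<^sup>2 * (\<mu> - a) - e\<^sup>2 * (\<mu> - c) = 0"
  shows "\<mu> \<le> L"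
proof -
  \<comment> \<open>the coordinates of an eigenvector of the tridiagonal matrix for the eigenvalue \<open>\<mu>\<close>\<close>
  define v1 v2 v3 where v: "v1 = e * h" "v2 = (\<mu> - a) * h" "v3 = (\<mu> - a) * (\<mu> - b) - e\<^sup>2"
  define z where "z = v1 *\<^sub>R q1 + v2 *\<^sub>R q2 + v3 *\<^sub>R q3"
  have zz: "z \<bullet> z = v1\<^sup>2 + v2\<^sup>2 + v3\<^sup>2"
    using unit orth by (simp add: z_def inner_add inner_commute[of q2 q1]
        inner_commute[of q3 q1] inner_commute[of q3 q2]
        power2_eq_square)
  have "z \<bullet> (H *v z)
      = v1 * (a * v1 + e * v2) + v2 * (e * v1 + b * v2 + h * v3) + v3 * (h * v2 + c * v3)"
    using diag offdiag by (simp add: z_def inner_add matrix_vector_right_distrib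
        matrix_vector_mult_scaleR sym[of q2 q1] sym[of q3 q1] sym[of q3 q2] algebra_simps)
  \<comment> \<open>The first two rows of the eigenvalue equation hold for every \<mu> by the choice
    of coordinates; only the third uses \<open>root\<close>.\<close>
  also have "a * v1 + e * v2 = \<mu> * v1" by (simp add: v algebra_simps)
  also have "e * v1 + b * v2 + h * v3 = \<mu> * v2" by (simp add: v algebra_simps power2_eq_square)
  also have "h * v2 + c * v3 = \<mu> * v3"
  proof -
    have "h * v2 = h\<^sup>2 * (\<mu> - a)" by (simp add: v power2_eq_square)
    also have "\<dots> = (\<mu> - c) * v3"
    proof -
      have "(\<mu> - c) * v3 - h\<^sup>2 * (\<mu> - a)
          = (\<mu> - a) * (\<mu> - b) * (\<mu> - c) - h\<^sup>2 * (\<mu> - a) - e\<^sup>2 * (\<mu> - c)"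
        by (simp add: v algebra_simps)
      with root show ?thesis by simp
    qed
    finally show ?thesis by (simp add: left_diff_distrib)
  qed
  finally have "z \<bullet> (H *v z) = \<mu> * (z \<bullet> z)"
    by (simp add: zz algebra_simps power2_eq_square)
  with upper[of z] have "\<mu> * (z \<bullet> z) \<le> L * (z \<bullet> z)" by simp
  moreover have "0 < z \<bullet> z"
    unfolding zz using nz by (intro add_pos_nonneg) (auto simp: v)
  ultimately show ?thesis by simp
qed

text \<open>The 2 by 2 analogue, for parallel \<open>g0\<close> and \<open>g2\<close>, with
  eigenvector coordinates \<open>e\<close> and \<open>\<mu> - a\<close>.\<close>

lemma bidiagonal_ritz_value_le:
  fixes H :: "real^'n^'n" and q1 q2 :: "real^'n"
  assumes sym: "\<And>y z. y \<bullet> (H *v z) = z \<bullet> (H *v y)"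
    and upper: "\<And>z. z \<bullet> (H *v z) \<le> L * (z \<bullet> z)"
    and unit: "q1 \<bullet> q1 = 1" "q2 \<bullet> q2 = 1" and orth: "q1 \<bullet> q2 = 0"
    and diag: "q1 \<bullet> (H *v q1) = a" "q2 \<bullet> (H *v q2) = b"
    and offdiag: "q1 \<bullet> (H *v q2) = e" and nz: "e \<noteq> 0"
    and root: "(\<mu> - a) * (\<mu> - b) - e\<^sup>2 = 0"
  shows "\<mu> \<le> L"
proof -
  define z where "z = e *\<^sub>R q1 + (\<mu> - a) *\<^sub>R q2"
  have zz: "z \<bullet> z = e\<^sup>2 + (\<mu> - a)\<^sup>2"
    using unit orth by (simp add: z_def inner_add inner_commute[of q2 q1] power2_eq_square)
  have "z \<bullet> (H *v z) = e * (a * e + e * (\<mu> - a)) + (\<mu> - a) * (e\<^sup>2 + b * (\<mu> - a))"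
    using diag offdiag by (simp add: z_def inner_add matrix_vector_right_distrib
        matrix_vector_mult_scaleR sym[of q2 q1] algebra_simps power2_eq_square)
  also have "e\<^sup>2 + b * (\<mu> - a) = \<mu> * (\<mu> - a)" using root by (simp add: algebra_simps)
  finally have "z \<bullet> (H *v z) = \<mu> * (z \<bullet> z)"
    by (simp add: zz algebra_simps power2_eq_square)
  with upper[of z] have "\<mu> * (z \<bullet> z) \<le> L * (z \<bullet> z)" by simp
  moreover have "0 < z \<bullet> z"
    unfolding zz using nz by (intro add_pos_nonneg) auto
  ultimately show ?thesis by simp
qed

text \<open>The discriminant is positive, so \<open>Max\<close> ranges over the two explicit real
  roots, and the larger one is at least \<open>a\<close>.\<close>

lemma Max_roots_quadratic:
  fixes a b \<beta> :: real
  assumes "0 < \<beta>"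
  defines "\<mu> \<equiv> Max {\<mu>. (\<mu> - a) * (\<mu> - b) - \<beta> = 0}"
  shows "(\<mu> - a) * (\<mu> - b) - \<beta> = 0" and "a \<le> \<mu>"
proof -
  define r where "r = sqrt ((a - b)\<^sup>2 + 4 * \<beta>)"
  have r2: "r\<^sup>2 = (a - b)\<^sup>2 + 4 * \<beta>" using assms by (simp add: r_def)
  have "a - b \<le> r" unfolding r_def using assms by (intro real_le_rsqrt) auto
  have "(x - a) * (x - b) - \<beta> = (x - (a + b + r) / 2) * (x - (a + b - r) / 2)" for x
    using r2 by (simp add: field_simps power2_eq_square)
  then have roots: "{\<mu>. (\<mu> - a) * (\<mu> - b) - \<beta> = 0} = {(a + b + r) / 2, (a + b - r) / 2}"
    by auto
  then have "\<mu> \<in> {\<mu>. (\<mu> - a) * (\<mu> - b) - \<beta> = 0}"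
    unfolding \<mu>_def by (intro Max_in) auto
  then show "(\<mu> - a) * (\<mu> - b) - \<beta> = 0" by simp
  have "(a + b + r) / 2 \<le> \<mu>" unfolding \<mu>_def roots by simp
  moreover have "a \<le> (a + b + r) / 2" using \<open>a - b \<le> r\<close> by (simp add: field_simps)
  ultimately show "a \<le> \<mu>" by linarith
qed

section \<open>Bounds for the Cauchy and NY stepsizes\<close>

lemma sd_step_pos:
  fixes H :: "real^'n^'n"
  assumes "\<And>z. z \<bullet> z \<le> z \<bullet> (H *v z)" and "g \<noteq> 0"
  shows "0 < sd_step H g"
proof -
  have "0 < g \<bullet> g" using assms(2) by simp
  moreover from this have "0 < g \<bullet> (H *v g)" using assms(1)[of g] by linarith
  ultimately show ?thesis by (simp add: sd_step_def)
qed

text \<open>Exact line search: this makes consecutive gradients orthogonal.\<close>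

lemma inner_sd_step_residual:
  assumes "g \<bullet> (H *v g) \<noteq> 0"
  shows "g \<bullet> (g - sd_step H g *\<^sub>R (H *v g)) = 0"
  using assms by (simp add: sd_step_def inner_diff_right)

lemma sd_step_scaleR: "c \<noteq> 0 \<Longrightarrow> sd_step H (c *\<^sub>R g) = sd_step H g"
  by (simp add: sd_step_def matrix_vector_mult_scaleR)

text \<open>The lower bound holds because the Rayleigh quotient of \<open>g2\<close> is a convex
  combination, with weight \<gamma>, of the outer diagonal entries, which the root dominates; the
  upper bound is the Ritz bound.\<close>

lemma ny_step_bounds:
  fixes H :: "real^'n^'n" and g0 g1 g2 :: "real^'n"
  assumes sym: "\<And>y z. y \<bullet> (H *v z) = z \<bullet> (H *v y)"
    and lower: "\<And>z. z \<bullet> z \<le> z \<bullet> (H *v z)"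
    and upper: "\<And>z. z \<bullet> (H *v z) \<le> L * (z \<bullet> z)"
    and nz: "g0 \<noteq> 0" "g1 \<noteq> 0" "g2 \<noteq> 0"
    and g1: "g1 = g0 - sd_step H g0 *\<^sub>R (H *v g0)"
    and g2: "g2 = g1 - sd_step H g1 *\<^sub>R (H *v g1)"
  shows "1 / sd_step H g2 \<le> inverse (ny_step H g0 g1 g2)"
    and "inverse (ny_step H g0 g1 g2) \<le> L"
proof -
  define a0 a1 where a: "a0 = sd_step H g0" "a1 = sd_step H g1"
  have a_pos: "0 < a0" "0 < a1" using sd_step_pos[OF lower] nz by (simp_all add: a)
  have Hpos: "0 < z \<bullet> (H *v z)" if "z \<noteq> 0" for z
    using that lower[of z] inner_gt_zero_iff[of z] by linarith
  have g01: "g0 \<bullet> g1 = 0"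
    using inner_sd_step_residual[of g0 H] Hpos[of g0] nz by (simp flip: g1)
  have g12: "g1 \<bullet> g2 = 0"
    using inner_sd_step_residual[of g1 H] Hpos[of g1] nz by (simp flip: g2)
  have Hg0: "H *v g0 = (1 / a0) *\<^sub>R (g0 - g1)" and Hg1: "H *v g1 = (1 / a1) *\<^sub>R (g1 - g2)"
    using g1 g2 a_pos by (simp_all add: a)
  define n0 n1 n2 k where n: "n0 = norm g0" "n1 = norm g1" "n2 = norm g2" and k: "k = g0 \<bullet> g2"
  have n_pos: "0 < n0" "0 < n1" "0 < n2" using nz by (simp_all add: n)
  have nn: "g0 \<bullet> g0 = n0\<^sup>2" "g1 \<bullet> g1 = n1\<^sup>2" "g2 \<bullet> g2 = n2\<^sup>2"
    by (simp_all add: n power2_norm_eq_inner)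
  define \<beta> \<gamma> where \<beta>: "\<beta> = n2\<^sup>2 / (a1\<^sup>2 * n1\<^sup>2)" and \<gamma>: "\<gamma> = k\<^sup>2 / (n0\<^sup>2 * n2\<^sup>2)"
  have "0 < \<beta>" using n_pos a_pos by (simp add: \<beta>)
  define q1 q2 where q: "q1 = (1 / n0) *\<^sub>R g0" "q2 = (1 / n1) *\<^sub>R g1"
  have unit: "q1 \<bullet> q1 = 1" "q2 \<bullet> q2 = 1" and orth: "q1 \<bullet> q2 = 0"
    using n_pos by (simp_all add: q nn g01 power2_eq_square)
  have diag: "q1 \<bullet> (H *v q1) = 1 / a0" "q2 \<bullet> (H *v q2) = 1 / a1"
    using n_pos by (simp_all add: q matrix_vector_mult_scaleR Hg0 Hg1 inner_diff_right nn g01 g12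
        power2_eq_square)
  \<comment> \<open>The entry \<open>e\<close> is computed twice: through \<open>Hg0\<close> it is
    visibly nonzero, through \<open>Hg1\<close> its square is
    \<open>\<beta> * \<gamma>\<close>.\<close>
  define e where "e = q1 \<bullet> (H *v q2)"
  have "e = q2 \<bullet> (H *v q1)" by (simp add: e_def sym)
  also have "\<dots> = - n1 / (a0 * n0)"
    using n_pos by (simp add: q matrix_vector_mult_scaleR Hg0 inner_diff_right nn g01
        inner_commute[of g1 g0] power2_eq_square)
  finally have e_nz: "e \<noteq> 0" using n_pos a_pos by simp
  have "e = - k / (a1 * n0 * n1)"
    by (simp add: e_def q matrix_vector_mult_scaleR Hg1 inner_diff_right g01 k)
  then have e2: "e\<^sup>2 = \<beta> * \<gamma>"
    using n_pos by (simp add: \<beta> \<gamma> power_divide power_mult_distrib)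
  have \<gamma>_le: "\<gamma> \<le> 1" and \<gamma>_iff: "\<gamma> = 1 \<longleftrightarrow> collinear {0, g0, g2}"
  proof -
    \<comment> \<open>\<open>r\<close> is the absolute cosine of the angle; equality in
      Cauchy-Schwarz characterises the parallel case.\<close>
    define r where "r = \<bar>g0 \<bullet> g2\<bar> / (norm g0 * norm g2)"
    have "\<gamma> = r\<^sup>2"
      by (simp add: r_def \<gamma> k n power_divide power_mult_distrib)
    moreover have "0 \<le> r" "r \<le> 1"
      using nz Cauchy_Schwarz_ineq2[of g0 g2] by (simp_all add: r_def divide_simps)
    moreover have "r = 1 \<longleftrightarrow> collinear {0, g0, g2}"
      using nz by (simp add: r_def divide_simps flip: norm_cauchy_schwarz_equal)
    ultimately show "\<gamma> \<le> 1" "\<gamma> = 1 \<longleftrightarrow> collinear {0, g0, g2}"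
      by (auto simp: power_le_one power2_eq_1_iff)
  qed
  have "0 \<le> \<gamma>" by (simp add: \<gamma>)
  have \<beta>\<gamma>: "(norm g2)\<^sup>2 / ((sd_step H g1)\<^sup>2 * (norm g1)\<^sup>2) = \<beta>"
      "(g2 \<bullet> g0)\<^sup>2 / ((norm g0)\<^sup>2 * (norm g2)\<^sup>2) = \<gamma>"
    by (simp_all add: \<beta> \<gamma> n a k inner_commute)
  have "1 / sd_step H g2 \<le> inverse (ny_step H g0 g1 g2) \<and> inverse (ny_step H g0 g1 g2) \<le> L"
  proof (cases "collinear {0, g0, g2}")
    case True
    then obtain c where "g2 = c *\<^sub>R g0" "c \<noteq> 0"
      using nz by (auto simp: collinear_lemma)
    then have sd: "sd_step H g2 = a0" by (simp add: a sd_step_scaleR)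
    have "\<gamma> = 1" using True \<gamma>_iff by simp
    define \<mu> where "\<mu> = Max {\<mu>. (\<mu> - 1 / a0) * (\<mu> - 1 / a1) - \<beta> = 0}"
    note \<mu> = Max_roots_quadratic[OF \<open>0 < \<beta>\<close>, of "1 / a0" "1 / a1", folded \<mu>_def]
    have "(\<mu> - 1 / a0) * (\<mu> - 1 / a1) - e\<^sup>2 = 0"
      using \<mu>(1) by (simp add: e2 \<open>\<gamma> = 1\<close>)
    then have "\<mu> \<le> L"
      by (rule bidiagonal_ritz_value_le[OF sym upper unit orth diag e_def[symmetric] e_nz])
    moreover have "inverse (ny_step H g0 g1 g2) = \<mu>"
      unfolding ny_step_def Let_def \<beta>\<gamma> by (simp add: True \<mu>_def a)
    ultimately show ?thesis using \<mu>(2) sd by simp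
  next
    case False
    then have "\<gamma> < 1" using \<gamma>_le \<gamma>_iff by linarith
    define a33 where "a33 = (1 / sd_step H g2 - \<gamma> / a0) / (1 - \<gamma>)"
    \<comment> \<open>One Gram-Schmidt projection suffices: \<open>g0\<close> and \<open>g2\<close>
      are both orthogonal to \<open>g1\<close>.\<close>
    define w where "w = g2 - (k / n0\<^sup>2) *\<^sub>R g0"
    have wg: "w \<bullet> g0 = 0" "w \<bullet> g1 = 0"
      using n_pos by (simp_all add: w_def inner_diff_left nn g01 g12 inner_commute[of g2] k)
    then have wg2: "w \<bullet> g2 = w \<bullet> w"
      by (simp add: w_def inner_diff_right)
    have ww: "w \<bullet> w = n2\<^sup>2 * (1 - \<gamma>)"
      unfolding wg2[symmetric] using n_pos
      by (simp add: w_def inner_diff_left nn k \<gamma> field_simps power2_eq_square)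
    define m where "m = norm w"
    have wm: "w \<bullet> w = m\<^sup>2" by (simp add: m_def power2_norm_eq_inner)
    have m2: "m\<^sup>2 = n2\<^sup>2 * (1 - \<gamma>)" using ww wm by simp
    have m_pos: "0 < m"
      using ww \<open>\<gamma> < 1\<close> n_pos by (auto simp: m_def)
    \<comment> \<open>\<open>H *v g0\<close> lies in the span of \<open>g0\<close> and
      \<open>g1\<close>, whence the zero corner entry.\<close>
    have wHg0: "w \<bullet> (H *v g0) = 0" by (simp add: Hg0 inner_diff_right wg)
    define q3 where "q3 = (1 / m) *\<^sub>R w"
    have unit3: "q3 \<bullet> q3 = 1" and orth3: "q1 \<bullet> q3 = 0" "q2 \<bullet> q3 = 0"
      using m_pos by (simp_all add: q3_def q wg inner_commute[of g0 w] inner_commute[of g1 w] wm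
          power2_eq_square)
    have off13: "q1 \<bullet> (H *v q3) = 0"
      by (subst sym) (simp add: q q3_def matrix_vector_mult_scaleR wHg0)
    define h where "h = q2 \<bullet> (H *v q3)"
    have "h = q3 \<bullet> (H *v q2)" by (simp add: h_def sym)
    also have "\<dots> = - m / (a1 * n1)"
      using m_pos by (simp add: q q3_def matrix_vector_mult_scaleR Hg1 inner_diff_right wg wg2 wm
          power2_eq_square)
    finally have h: "h = - m / (a1 * n1)" .
    then have h_nz: "h \<noteq> 0" using m_pos n_pos a_pos by simp
    have h2: "h\<^sup>2 = \<beta> * (1 - \<gamma>)"
      by (simp add: h power_divide power_mult_distrib m2 \<beta>)
    \<comment> \<open>The cross terms vanish by \<open>wHg0\<close>; the computation identifies
      \<open>a33\<close> as the Rayleigh quotient of \<open>w\<close>.\<close>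
    have "w \<bullet> (H *v w) = g2 \<bullet> (H *v g2) - (k / n0\<^sup>2)\<^sup>2 * (g0 \<bullet> (H *v g0))"
    proof -
      have "g2 = w + (k / n0\<^sup>2) *\<^sub>R g0" by (simp add: w_def)
      then show ?thesis
        by (simp add: inner_add matrix_vector_right_distrib matrix_vector_mult_scaleR wHg0
            sym[of g0 w] power2_eq_square)
    qed
    also have "g2 \<bullet> (H *v g2) = n2\<^sup>2 / sd_step H g2"
      using Hpos[of g2] nz n_pos by (simp add: sd_step_def nn)
    also have "(k / n0\<^sup>2)\<^sup>2 * (g0 \<bullet> (H *v g0)) = n2\<^sup>2 * (\<gamma> / a0)"
      using n_pos by (simp add: Hg0 inner_diff_right nn g01 \<gamma> power2_eq_square)
    also have "n2\<^sup>2 / sd_step H g2 - n2\<^sup>2 * (\<gamma> / a0) = (1 / sd_step H g2 - \<gamma> / a0) * n2\<^sup>2"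
      by (simp add: left_diff_distrib)
    also have "\<dots> = a33 * m\<^sup>2"
      using \<open>\<gamma> < 1\<close> by (simp add: a33_def m2)
    finally have "w \<bullet> (H *v w) = a33 * m\<^sup>2" .
    then have diag3: "q3 \<bullet> (H *v q3) = a33"
      using m_pos by (simp add: q3_def matrix_vector_mult_scaleR power2_eq_square)
    define \<mu> where "\<mu> = inverse (ny_step H g0 g1 g2)"
    have \<mu>: "(\<mu> - 1 / a0) * (\<mu> - 1 / a1) * (\<mu> - a33)
        - \<beta> * (1 - \<gamma>) * (\<mu> - 1 / a0) - \<beta> * \<gamma> * (\<mu> - a33) = 0"
      "1 / a0 \<le> \<mu>" "a33 \<le> \<mu>"
      unfolding \<mu>_def ny_step_def Let_def \<beta>\<gamma>
      unfolding a[symmetric] if_not_P[OF False] inverse_inverse_eq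
        a33_def[symmetric]
      by (rule tridiagonal_cubic_trig_root[OF \<open>0 < \<beta>\<close> \<open>0 \<le> \<gamma>\<close> \<gamma>_le,
            where a = "1 / a0" and b = "1 / a1" and c = a33])+
    have "\<mu> \<le> L"
      using \<mu>(1) unfolding h2[symmetric] e2[symmetric]
      by (rule tridiagonal_ritz_value_le[OF sym upper unit unit3 orth orth3 diag diag3
            e_def[symmetric] h_def[symmetric] off13 e_nz h_nz])
    moreover have "1 / sd_step H g2 \<le> \<mu>"
    proof -
      have "1 / sd_step H g2 = \<gamma> * (1 / a0) + (1 - \<gamma>) * a33"
        using \<open>\<gamma> < 1\<close> by (simp add: a33_def)
      also have "\<dots> \<le> \<gamma> * \<mu> + (1 - \<gamma>) * \<mu>"
        using \<mu>(2,3) \<open>0 \<le> \<gamma>\<close> \<open>\<gamma> < 1\<close> by (intro add_mono mult_left_mono) auto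
      finally show ?thesis by (simp add: algebra_simps)
    qed
    ultimately show ?thesis by (simp add: \<mu>_def)
  qed
  then show "1 / sd_step H g2 \<le> inverse (ny_step H g0 g1 g2)" "inverse (ny_step H g0 g1 g2) \<le> L"
    by auto
qed

section \<open>Diagonal Hessian and gradient of the quadratic\<close>

lemma diag_mult_vec_nth: "(diag l *v z) $ i = l i * z $ i"
  by (simp add: diag_def matrix_vector_mult_def if_distrib[of "\<lambda>c. c * _"] cong: if_cong)

lemma inner_diag_mult_vec: "y \<bullet> (diag l *v z) = (\<Sum>i\<in>UNIV. l i * (y $ i * z $ i))"
  by (simp add: inner_vec_def diag_mult_vec_nth ac_simps)

lemma GDERIV_quadratic_unique:
  fixes H :: "real^'n^'n"
  assumes sym: "\<And>y z. y \<bullet> (H *v z) = z \<bullet> (H *v y)"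
    and "GDERIV (quadratic H b) x :> g"
  shows "g = H *v x + b"
proof -
  have "((\<lambda>x. H *v x) has_derivative (\<lambda>h. H *v h)) (at x)"
    by (rule bounded_linear_imp_has_derivative) simp
  then have "((\<lambda>x. 1/2 * (x \<bullet> (H *v x)) + b \<bullet> x) has_derivative
      (\<lambda>h. 1/2 * (x \<bullet> (H *v h) + h \<bullet> (H *v x)) + b \<bullet> h)) (at x)"
    by (intro has_derivative_add has_derivative_mult_right has_derivative_inner
        has_derivative_inner_right has_derivative_ident)
  moreover have "(\<lambda>h. 1/2 * (x \<bullet> (H *v h) + h \<bullet> (H *v x)) + b \<bullet> h) = (\<lambda>h. h \<bullet> (H *v x + b))"
    by (simp add: sym[of x] inner_add_right inner_commute[of b])
  ultimately have "(quadratic H b has_derivative (\<lambda>h. h \<bullet> (H *v x + b))) (at x)"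
    unfolding quadratic_def[abs_def] by simp
  then have "(\<lambda>h. h \<bullet> (H *v x + b)) = (\<lambda>h. h \<bullet> g)"
    using assms(2) unfolding gderiv_def by (rule has_derivative_unique)
  then have "h \<bullet> (H *v x + b) = h \<bullet> g" for h
    by (rule fun_cong)
  then have "(g - (H *v x + b)) \<bullet> (g - (H *v x + b)) = 0"
    by (simp only: inner_diff_right diff_self)
  then show ?thesis by (simp only: inner_eq_zero_iff eq_iff_diff_eq_0[of g])
qed

section \<open>Stepsize bounds along the run and convergence\<close>

text \<open>Cauchy and NY steps take \<open>v = k\<close>; a copied step inherits \<open>v\<close>
  from its predecessor. The delay grows with the residue, so it stays within one cycle.\<close>

lemma ny_run_step_bounds:
  fixes H :: "real^'n^'n"
  assumes sym: "\<And>y z. y \<bullet> (H *v z) = z \<bullet> (H *v y)"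
    and lower: "\<And>z. z \<bullet> z \<le> z \<bullet> (H *v z)"
    and upper: "\<And>z. z \<bullet> (H *v z) \<le> L * (z \<bullet> z)"
    and T: "3 \<le> T" and run: "ny_run H T x g \<alpha>"
    and g: "\<And>k. g (Suc k) = g k - \<alpha> k *\<^sub>R (H *v g k)" and nz: "\<And>k. g k \<noteq> 0"
  shows "\<exists>v\<le>k. k \<le> v + k mod T \<and> 1 / sd_step H (g v) \<le> inverse (\<alpha> k) \<and> inverse (\<alpha> k) \<le> L"
proof (induction k rule: less_induct)
  case (less k)
  have \<alpha>: "\<alpha> k = (if k mod T < 2 then sd_step H (g k)
             else if k mod T = 2 then ny_step H (g (k - 2)) (g (k - 1)) (g k)
             else \<alpha> (k - 1))" for k
    using run nz by (auto simp: ny_run_def)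
  consider "k mod T < 2" | "k mod T = 2" | "2 < k mod T" by linarith
  then show ?case
  proof cases
    case 1
    have "1 / sd_step H (g k) \<le> L"
      using upper[of "g k"] nz[of k] by (simp add: sd_step_def divide_simps)
    with 1 \<alpha>[of k] show ?thesis by (intro exI[of _ k]) (simp add: inverse_eq_divide)
  next
    case 2
    define j where "j = k - 2"
    \<comment> \<open>Hence the truncated subtractions \<open>k - 2\<close> and \<open>k - 1\<close>
      are genuine, and \<open>3 \<le> T\<close> makes both of those iterations Cauchy steps.\<close>
    have "2 \<le> k" using 2 mod_less_eq_dividend[of k T] by simp
    then have k: "k = Suc (Suc j)" by (simp add: j_def)
    have "j mod T = 0" "Suc j mod T = 1"
      using 2 T by (auto simp: k mod_Suc split: if_splits)
    then have "\<alpha> j = sd_step H (g j)" "\<alpha> (Suc j) = sd_step H (g (Suc j))"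
      using \<alpha>[of j] \<alpha>[of "Suc j"] by simp_all
    then have "1 / sd_step H (g k) \<le> inverse (ny_step H (g j) (g (Suc j)) (g k))"
       "inverse (ny_step H (g j) (g (Suc j)) (g k)) \<le> L"
      using ny_step_bounds[OF sym lower upper nz[of j] nz[of "Suc j"] nz[of k]] g[of j] g[of "Suc j"]
      unfolding k by metis+
    with 2 \<alpha>[of k] show ?thesis by (intro exI[of _ k]) (simp add: k)
  next
    case 3
    then obtain j where k: "k = Suc j" by (cases k) auto
    then have "k mod T = Suc (j mod T)" using 3 by (auto simp: mod_Suc split: if_splits)
    moreover have "\<alpha> k = \<alpha> j" using \<alpha>[of k] 3 k by simp
    moreover obtain v where "v \<le> j" "j \<le> v + j mod T" "1 / sd_step H (g v) \<le> inverse (\<alpha> j)"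
        "inverse (\<alpha> j) \<le> L"
      using less[of j] k by blast
    ultimately show ?thesis using k by (intro exI[of _ v]) simp
  qed
qed

theorem theorem3p2:
  fixes l :: "'n::{finite,linorder} \<Rightarrow> real"
    and H :: "real^'n::{finite,linorder}^'n::{finite,linorder}"
    and d :: "'n \<Rightarrow> real^'n::{finite,linorder}"
    and b :: "real^'n::{finite,linorder}"
    and x g :: "nat \<Rightarrow> real^'n::{finite,linorder}"
    and \<alpha> :: "nat \<Rightarrow> real"
    and T :: nat
  assumes "H = diag l"
    and "antimono l"
    and "l (Max UNIV) = 1"
    and "\<forall>i. H *v d i = l i *\<^sub>R d i"
    and "\<forall>i j. d i \<bullet> d j = (if i = j then 1 else 0)"
    and "T \<ge> 3"
    and "\<forall>k. GDERIV (quadratic H b) (x k) :> g k"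
    and "ny_run H T x g \<alpha>"
    and "g 0 \<bullet> d (Min UNIV) \<noteq> 0"
    and "g 0 \<bullet> d (Max UNIV) \<noteq> 0"
  shows "(\<exists>k. g k = 0) \<or> R_linear_to_zero (\<lambda>k. norm (g k))"
proof (cases "\<exists>k. g k = 0")
  case False
  then have nz: "g k \<noteq> 0" for k by blast
  define L where "L = l (Min UNIV)"
  have l: "1 \<le> l i" "l i \<le> L" for i
    using antimonoD[OF assms(2), of i "Max UNIV"] antimonoD[OF assms(2), of "Min UNIV" i] assms(3)
    by (auto simp: L_def)
  have sym: "y \<bullet> (H *v z) = z \<bullet> (H *v y)" for y z
    by (simp add: assms(1) inner_diag_mult_vec mult.commute)
  have lower: "z \<bullet> z \<le> z \<bullet> (H *v z)" for z
    unfolding assms(1) inner_diag_mult_vec unfolding inner_vec_def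
  proof (rule sum_mono)
    show "z $ i \<bullet> z $ i \<le> l i * (z $ i * z $ i)" for i
      using mult_right_mono[OF l(1)[of i], of "z $ i * z $ i"] by simp
  qed
  have upper: "z \<bullet> (H *v z) \<le> L * (z \<bullet> z)" for z
    unfolding assms(1) inner_diag_mult_vec unfolding inner_vec_def sum_distrib_left
    by (intro sum_mono) (use l in \<open>auto intro: mult_right_mono\<close>)
  have grad: "g k = H *v x k + b" for k
    using assms(7) GDERIV_quadratic_unique[OF sym] by blast
  have rec: "g (Suc k) = g k - \<alpha> k *\<^sub>R (H *v g k)" for k
  proof -
    have "x (Suc k) = x k - \<alpha> k *\<^sub>R g k" using assms(8) nz by (simp add: ny_run_def)
    then show ?thesis
      by (simp add: grad[of "Suc k"] grad[of k] matrix_vector_mult_diff_distrib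
          matrix_vector_mult_scaleR)
  qed
  have bounds: "\<exists>v\<le>k. k \<le> v + T \<and> 1 / L \<le> \<alpha> k \<and> \<alpha> k \<le> 1
      \<and> \<alpha> k * (\<Sum>j\<in>UNIV. l j * (g v $ j)\<^sup>2) \<le> (\<Sum>j\<in>UNIV. (g v $ j)\<^sup>2)" for k
  proof -
    obtain v where v: "v \<le> k" "k \<le> v + k mod T" "1 / sd_step H (g v) \<le> inverse (\<alpha> k)"
        "inverse (\<alpha> k) \<le> L"
      using ny_run_step_bounds[OF sym lower upper assms(6,8) rec nz] by blast
    have gg: "0 < g v \<bullet> g v" using nz by simp
    \<comment> \<open>Rayleigh quotients are at least the smallest eigenvalue 1, which yields
      \<open>\<alpha> k \<le> 1\<close>.\<close>
    have "1 \<le> 1 / sd_step H (g v)"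
      using lower[of "g v"] gg by (simp add: sd_step_def)
    with v(3) have inv: "1 \<le> inverse (\<alpha> k)" by linarith
    then have \<alpha>: "0 < \<alpha> k" by (metis inverse_positive_iff_positive less_le_trans zero_less_one)
    have "\<alpha> k * (g v \<bullet> (H *v g v)) \<le> g v \<bullet> g v"
      using v(3) \<alpha> gg by (simp add: sd_step_def field_simps)
    moreover have "1 / L \<le> \<alpha> k" "\<alpha> k \<le> 1"
      using v(4) inv \<alpha> l[of "Min UNIV"] by (auto simp: field_simps)
    moreover have "k \<le> v + T"
      using v(2) assms(6) mod_less_divisor[of T k] by linarith
    ultimately show ?thesis
      using v(1) unfolding assms(1) inner_diag_mult_vec unfolding inner_vec_def
      by (auto simp: power2_eq_square)
  qed
  have "\<exists>C \<theta>. 0 < C \<and> 0 < \<theta> \<and> \<theta> < 1 \<and> (\<forall>k. \<bar>g k $ i\<bar> \<le> C * \<theta> ^ k)" for i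
  proof (rule short_delayed_steps_imp_geometric[where l = l and L = L and \<alpha> = \<alpha> and m = T])
    show "g (Suc k) $ i = (1 - \<alpha> k * l i) * g k $ i" for k i
      by (simp add: rec assms(1) diag_mult_vec_nth algebra_simps)
  qed (use l bounds in blast)+
  then obtain C \<theta> where C: "0 < C" "0 < \<theta>" "\<theta> < 1" "\<And>k. (\<Sum>i\<in>UNIV. \<bar>g k $ i\<bar>) \<le> C * \<theta> ^ k"
    using sum_geometric_bound[of UNIV "\<lambda>k i. \<bar>g k $ i\<bar>"] by auto
  then have "\<bar>norm (g k)\<bar> \<le> C * \<theta> ^ k" for k
    using norm_le_l1_cart[of "g k"] by (auto intro: order_trans)
  with C show ?thesis
    unfolding R_linear_to_zero_def by blast
qed simp

end
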